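(* For $p,q\in\mathbb{R}$ let $H_{p,q}(x)=\dfrac{U_p\left(\frac{\sinh x}{x}\right)}{U_q(\cosh x)}$ for $x\in(0,\infty)$. Let $$\mathbb{I}_1=\{(p,q):q=0,p>0\}\cup\{(p,q):q>0,\tfrac pq\ge\tfrac{23}{17}\}\cup\{(p,q):q<0,\tfrac pq\le1\},$$ $$\mathbb{I}_2=\{(p,q):q=0,p<0\}\cup\{(p,q):q>0,\tfrac pq\le1\}\cup\{(p,q):q<0,\tfrac pq\ge\tfrac{23}{17}\}.$$ Then: (i) $H_{p,q}$ is increasing on $(0,\infty)$ if $(p,q)\in\mathbb{I}_1\cup\{(0,0)\}$ and $\frac58p-\frac{15}8q+1\ge0$; (ii) $H_{p,q}$ is decreasing on $(0,\infty)$ if $(p,q)\in\mathbb{I}_2$ and $\frac58p-\frac{15}8q+1\le0$.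
   Context: For $r\in\mathbb{R}$ and $t\in(1,\infty)$: $U_r(t)=\frac{t^r-1}{r}$ if $r\ne0$, and $U_0(t)=\ln t$. *)

theory Defs
  imports Complex_Main
begin

(* Meant for t > 1. The values used below, sinh x / x and cosh x with x > 0, satisfy this. *)
definition U :: "real \<Rightarrow> real \<Rightarrow> real" where
  "U r t = (if r = 0 then ln t else (t powr r - 1) / r)"

definition H :: "real \<Rightarrow> real \<Rightarrow> real \<Rightarrow> real" where
  "H p q x = U p (sinh x / x) / U q (cosh x)"

definition I1 :: "(real \<times> real) set" where
  "I1 = {(p, q). q = 0 \<and> p > 0} \<union> {(p, q). q > 0 \<and> p / q \<ge> 23 / 17}
      \<union> {(p, q). q < 0 \<and> p / q \<le> 1}"

definition I2 :: "(real \<times> real) set" where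
  "I2 = {(p, q). q = 0 \<and> p < 0} \<union> {(p, q). q > 0 \<and> p / q \<le> 1}
      \<union> {(p, q). q < 0 \<and> p / q \<ge> 23 / 17}"

end

theory Submission
  imports Defs
begin

text \<open>By the monotone form of l'Hospital's rule it suffices that the quotient of the derivatives
  of \<open>U\<^sub>p(sinh x / x)\<close> and \<open>U\<^sub>q(cosh x)\<close> is strictly monotone. Up to a positive factor the
  logarithmic derivative of that quotient is \<open>p a - q b + c\<close>, where \<open>a\<close>, \<open>b\<close>, \<open>c\<close> are polynomials
  in \<open>x\<close>, \<open>sinh x\<close>, \<open>cosh x\<close>. With \<open>a' = a - 5/8 c\<close> and \<open>b' = b - 15/8 c\<close> it equals
  \<open>p a' - q b' + (5/8 p - 15/8 q + 1) c\<close>, and the inequalities \<open>c > 0\<close> and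
  \<open>a' < b' < 23/17 a'\<close> hold because \<open>c\<close>, \<open>b' - a'\<close> and \<open>23 a' - 17 b'\<close> have power series with
  nonnegative coefficients.\<close>

section \<open>The monotone form of l'Hospital's rule\<close>

text \<open>On \<open>(0, x]\<close> the function decreases strictly, and its limit 0 bounds
  \<open>f (x/2)\<close> from above; going through \<open>x/2\<close> keeps the last inequality
  strict. The sign of the derivative is asked only for \<open>t < x\<close> because in
  \<open>strict_mono_on_quotient\<close> the derivative vanishes at \<open>x\<close>.\<close>

lemma neg_if_deriv_neg_tendsto_0:
  fixes f f' :: "real \<Rightarrow> real"
  assumes "0 < x" and lim: "(f \<longlongrightarrow> 0) (at_right 0)"
    and der: "\<And>t. 0 < t \<Longrightarrow> t \<le> x \<Longrightarrow> (f has_real_derivative f' t) (at t)"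
    and neg: "\<And>t. 0 < t \<Longrightarrow> t < x \<Longrightarrow> f' t < 0"
  shows "f x < 0"
proof -
  have dec: "f v < f u" if "0 < u" "u < v" "v \<le> x" for u v
  proof (rule DERIV_neg_imp_decreasing_open[OF \<open>u < v\<close>])
    show "\<exists>y. (f has_real_derivative y) (at t) \<and> y < 0" if "u < t" "t < v" for t
      using der[of t] neg[of t] that \<open>0 < u\<close> \<open>v \<le> x\<close> by auto
    have "isCont f t" if "t \<in> {u..v}" for t
      using der[of t] that \<open>0 < u\<close> \<open>v \<le> x\<close> by (auto intro: DERIV_isCont)
    then show "continuous_on {u..v} f"
      by (simp add: continuous_at_imp_continuous_on)
  qed
  have "eventually (\<lambda>t. f (x/2) \<le> f t) (at_right 0)"
    unfolding eventually_at_right_field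
    using \<open>0 < x\<close> by (intro exI[of _ "x/2"]) (auto intro!: less_imp_le dec)
  then have "f (x/2) \<le> 0"
    by (intro tendsto_lowerbound[OF lim]) auto
  with dec[of "x/2" x] \<open>0 < x\<close> show ?thesis by simp
qed

lemma pos_if_deriv_pos_tendsto_0:
  fixes f f' :: "real \<Rightarrow> real"
  assumes "0 < x" and lim: "(f \<longlongrightarrow> 0) (at_right 0)"
    and der: "\<And>t. 0 < t \<Longrightarrow> t \<le> x \<Longrightarrow> (f has_real_derivative f' t) (at t)"
    and pos: "\<And>t. 0 < t \<Longrightarrow> t < x \<Longrightarrow> 0 < f' t"
  shows "0 < f x"
proof -
  have "- f x < 0"
  proof (rule neg_if_deriv_neg_tendsto_0[OF \<open>0 < x\<close>])
    show "((\<lambda>t. - f t) \<longlongrightarrow> 0) (at_right 0)"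
      using tendsto_minus[OF lim] by simp
    show "((\<lambda>t. - f t) has_real_derivative - f' t) (at t)" if "0 < t" "t \<le> x" for t
      using der[OF that] by (rule DERIV_minus)
    show "- f' t < 0" if "0 < t" "t < x" for t
      using pos[OF that] by simp
  qed
  then show ?thesis by simp
qed

text \<open>The derivative of \<open>f / g\<close> has the sign of \<open>k x * g x - f x\<close>,
  where \<open>k\<close> is the quotient of the derivatives of \<open>f\<close> and
  \<open>g\<close>.\<close>

lemma strict_mono_on_quotient:
  fixes f g g' k :: "real \<Rightarrow> real"
  assumes f: "(f \<longlongrightarrow> 0) (at_right 0)" and g: "(g \<longlongrightarrow> 0) (at_right 0)"
    and df: "\<And>x. 0 < x \<Longrightarrow> (f has_real_derivative k x * g' x) (at x)"
    and dg: "\<And>x. 0 < x \<Longrightarrow> (g has_real_derivative g' x) (at x)"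
    and pos: "\<And>x. 0 < x \<Longrightarrow> 0 < g' x"
    and k: "strict_mono_on {0<..} k"
  shows "strict_mono_on {0<..} (\<lambda>x. f x / g x)"
proof (rule strict_mono_onI)
  fix u v :: real
  assume "u \<in> {0<..}" "v \<in> {0<..}" "u < v"
  have gpos: "0 < g x" if "0 < x" for x
    by (rule pos_if_deriv_pos_tendsto_0[where f' = g']) (use that g dg pos in auto)
  have less: "f x < k x * g x" if "0 < x" for x
  proof -
    have "f x - k x * g x < 0"
    \<comment> \<open>Freezing \<open>k\<close> at its value \<open>k x\<close> gives a function of
      \<open>t\<close> with derivative \<open>(k t - k x) * g' t\<close>, negative to the left of
      \<open>x\<close>.\<close>
    proof (rule neg_if_deriv_neg_tendsto_0[OF that, where f = "\<lambda>t. f t - k x * g t"])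
      show "((\<lambda>t. f t - k x * g t) \<longlongrightarrow> 0) (at_right 0)"
        using tendsto_diff[OF f tendsto_mult_left[OF g, of "k x"]] by simp
      show "((\<lambda>t. f t - k x * g t) has_real_derivative (k t - k x) * g' t) (at t)"
        if "0 < t" for t
        using that by (auto intro!: derivative_eq_intros df dg simp: algebra_simps)
      show "(k t - k x) * g' t < 0" if "0 < t" "t < x" for t
        using strict_mono_onD[OF k, of t x] pos[of t] that by (simp add: mult_neg_pos)
    qed
    then show ?thesis by simp
  qed
  show "f u / g u < f v / g v"
  proof (rule DERIV_pos_imp_increasing[OF \<open>u < v\<close>])
    fix x assume "u \<le> x" "x \<le> v"
    then have "0 < x" using \<open>u \<in> {0<..}\<close> by auto
    have "((\<lambda>x. f x / g x) has_real_derivative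
        g' x * (k x * g x - f x) / (g x * g x)) (at x)"
      using df[OF \<open>0 < x\<close>] dg[OF \<open>0 < x\<close>] gpos[OF \<open>0 < x\<close>]
      by (auto intro!: derivative_eq_intros simp: algebra_simps)
    moreover have "0 < g' x * (k x * g x - f x) / (g x * g x)"
      using pos[OF \<open>0 < x\<close>] gpos[OF \<open>0 < x\<close>] less[OF \<open>0 < x\<close>] by simp
    ultimately show "\<exists>y. ((\<lambda>x. f x / g x) has_real_derivative y) (at x) \<and> 0 < y"
      by blast
  qed
qed

section \<open>Hyperbolic inequalities from power series\<close>

lemma sums_pos:
  fixes f :: "nat \<Rightarrow> real"
  assumes "f sums l" "\<And>n. 0 \<le> f n" "0 < f k"
  shows "0 < l"
  using suminf_pos2[of f k] assms by (simp add: sums_iff)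

lemma cosh_sums: "(\<lambda>n. x ^ (2 * n) / fact (2 * n)) sums cosh (x :: real)"
proof -
  have "(\<lambda>n. if even n then x ^ n /\<^sub>R fact n else 0) sums cosh x"
    by (rule cosh_converges)
  then have "(\<lambda>n. if even (2*n) then x ^ (2*n) /\<^sub>R fact (2*n) else 0) sums cosh x"
    by (subst sums_mono_reindex[of "\<lambda>n. 2 * n"]) (auto simp: strict_mono_def elim!: evenE)
  then show ?thesis by (simp add: field_simps)
qed

lemma sinh_sums: "(\<lambda>n. x ^ (2 * n + 1) / fact (2 * n + 1)) sums sinh (x :: real)"
proof -
  have "(\<lambda>n. if even n then 0 else x ^ n /\<^sub>R fact n) sums sinh x"
    by (rule sinh_converges)
  then have "(\<lambda>n. if even (2*n+1) then 0 else x ^ (2*n+1) /\<^sub>R fact (2*n+1)) sums sinh x"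
    by (subst sums_mono_reindex[of "\<lambda>n. 2 * n + 1"]) (auto simp: strict_mono_def elim!: oddE)
  then show ?thesis by (simp add: field_simps)
qed

text \<open>The weight \<open>2 * n\<close> rewrites the series in the terms
  \<open>x ^ (2 * n) / fact (2 * n)\<close> of \<open>cosh\<close>, so that linear combinations can
  be judged coefficient by coefficient. The weight is 0 at \<open>n = 0\<close>, which absorbs the
  index shift.\<close>

lemma mult_sinh_sums:
  "(\<lambda>n. real (2 * n) * (x ^ (2 * n) / fact (2 * n))) sums (x * sinh (x :: real))"
proof -
  define h where "h n = real (2 * n) * (x ^ (2 * n) / fact (2 * n))" for n
  have "x * (x ^ (2 * n + 1) / fact (2 * n + 1)) = h (Suc n)" for n
    unfolding h_def by (simp add: divide_simps)
  then have "(\<lambda>n. h (Suc n)) sums (x * sinh x)"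
    using sums_mult[OF sinh_sums, of x x] by simp
  from sums_Suc[OF this] show ?thesis by (simp add: h_def)
qed

lemma power2_mult_cosh_sums:
  "(\<lambda>n. real (2 * n) * (real (2 * n) - 1) * (x ^ (2 * n) / fact (2 * n)))
     sums (x\<^sup>2 * cosh (x :: real))"
proof -
  define h where "h n = real (2 * n) * (real (2 * n) - 1) * (x ^ (2 * n) / fact (2 * n))" for n
  have "x\<^sup>2 * (x ^ (2 * n) / fact (2 * n)) = h (Suc n)" for n
    unfolding h_def by (simp add: divide_simps) (simp add: algebra_simps power2_eq_square)
  then have "(\<lambda>n. h (Suc n)) sums (x\<^sup>2 * cosh x)"
    using sums_mult[OF cosh_sums, of "x\<^sup>2" x] by simp
  from sums_Suc[OF this] show ?thesis by (simp add: h_def)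
qed

text \<open>The triple argument formulas make cubic hyperbolic polynomials linear in
  \<open>cosh (3 * x)\<close> and \<open>sinh (3 * x)\<close>, whose power series are
  explicit.\<close>

lemma cosh_triple: "cosh (3 * x) = 4 * cosh x ^ 3 - 3 * cosh (x :: real)"
proof -
  have "cosh (3 * x) = cosh (2 * x + x)" by simp
  also have "\<dots> = (cosh x ^ 2 + sinh x ^ 2) * cosh x + 2 * sinh x * cosh x * sinh x"
    by (simp only: cosh_add cosh_double sinh_double)
  also have "\<dots> = 4 * cosh x ^ 3 - 3 * cosh x"
    using sinh_square_eq[of x] by algebra
  finally show ?thesis .
qed

lemma sinh_triple: "sinh (3 * x) = 4 * sinh x ^ 3 + 3 * sinh (x :: real)"
proof -
  have "sinh (3 * x) = sinh (2 * x + x)" by simp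
  also have "\<dots> = 2 * sinh x * cosh x * cosh x + (cosh x ^ 2 + sinh x ^ 2) * sinh x"
    by (simp only: sinh_add cosh_double sinh_double)
  also have "\<dots> = 4 * sinh x ^ 3 + 3 * sinh x"
    using cosh_square_eq[of x] by algebra
  finally show ?thesis .
qed

text \<open>\<open>d n\<close> is the coefficient of \<open>x ^ (2 * n) / fact (2 * n)\<close> in
  the combination; \<open>9 ^ n\<close> comes from \<open>(3 * x) ^ (2 * n)\<close>.\<close>

lemma hyperbolic_combination_pos:
  fixes x a b c a' b' c' :: real
  defines "d \<equiv> \<lambda>n. 9 ^ n * (a + b * real (2 * n) + c * (real (2 * n) * (real (2 * n) - 1)))
      + (a' + b' * real (2 * n) + c' * (real (2 * n) * (real (2 * n) - 1)))"
  assumes "0 < x" "\<And>n. 0 \<le> d n" "0 < d k"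
  shows "0 < a * cosh (3 * x) + b * (3 * x * sinh (3 * x)) + c * ((3 * x)\<^sup>2 * cosh (3 * x))
      + (a' * cosh x + b' * (x * sinh x) + c' * (x\<^sup>2 * cosh x))" (is "0 < ?S")
proof -
  define w where "w y n = y ^ (2 * n) / fact (2 * n)" for y :: real and n :: nat
  have w3: "w (3 * x) n = 9 ^ n * w x n" for n
    by (simp add: w_def power_mult_distrib power_mult)
  have w: "0 < w x n" for n using \<open>0 < x\<close> by (simp add: w_def)
  note sums = cosh_sums mult_sinh_sums power2_mult_cosh_sums
  have "(\<lambda>n. a * w (3 * x) n + b * (real (2 * n) * w (3 * x) n)
        + c * (real (2 * n) * (real (2 * n) - 1) * w (3 * x) n)
        + (a' * w x n + b' * (real (2 * n) * w x n)
        + c' * (real (2 * n) * (real (2 * n) - 1) * w x n))) sums ?S"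
    unfolding w_def by (intro sums_add sums_mult sums)
  also have "(\<lambda>n. a * w (3 * x) n + b * (real (2 * n) * w (3 * x) n)
        + c * (real (2 * n) * (real (2 * n) - 1) * w (3 * x) n)
        + (a' * w x n + b' * (real (2 * n) * w x n)
        + c' * (real (2 * n) * (real (2 * n) - 1) * w x n))) = (\<lambda>n. d n * w x n)"
    unfolding w3 d_def by (simp add: fun_eq_iff algebra_simps)
  finally show ?thesis
    by (rule sums_pos[where k = k]) (use assms w in \<open>auto simp: less_imp_le\<close>)
qed

text \<open>One generous bound for the tails of two coefficient sequences below. It holds at 5,
  where 32400 < 59049, but fails at 4; the induction step is
  \<open>(n + 1)^2 <= 9 * n^2\<close>.\<close>

lemma power2_le_nine_power:
  assumes "5 \<le> n"
  shows "1296 * (real n)\<^sup>2 \<le> 9 ^ n"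
  using assms
proof (induction n rule: dec_induct)
  case (step n)
  have "real n \<ge> 5" using step by simp
  then have "5 * real n \<le> real n * real n" by (intro mult_right_mono) auto
  with \<open>real n \<ge> 5\<close> have "1296 * (real (Suc n))\<^sup>2 \<le> 9 * (1296 * (real n)\<^sup>2)"
    unfolding power2_eq_square of_nat_Suc distrib_left distrib_right mult_1 mult_1_right
    by linarith
  also have "\<dots> \<le> 9 ^ Suc n" using step by simp
  finally show ?case .
qed simp

text \<open>The functions \<open>a\<close>, \<open>b\<close>, \<open>c\<close>: numerators over \<open>x sinh x cosh x (x cosh x - sinh x)\<close> of
  \<open>coth x - 1/x\<close>, of \<open>tanh x\<close>, and of the part of the logarithmic derivative free of \<open>p\<close> and \<open>q\<close>.\<close>

definition numer_A :: "real \<Rightarrow> real" where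
  "numer_A x = cosh x * (x * cosh x - sinh x)\<^sup>2"

definition numer_B :: "real \<Rightarrow> real" where
  "numer_B x = x * (sinh x)\<^sup>2 * (x * cosh x - sinh x)"

definition numer_C :: "real \<Rightarrow> real" where
  "numer_C x = (sinh x)\<^sup>2 * cosh x + x * sinh x - 2 * x\<^sup>2 * cosh x"

section \<open>Signs of combinations of \<open>numer_A\<close>, \<open>numer_B\<close> and
  \<open>numer_C\<close> for positive \<open>x\<close>\<close>

context
  fixes x :: real
  assumes x: "0 < x"
begin

lemma numer_C_pos: "0 < numer_C x"
proof -
  have d: "0 \<le> 9 ^ n * (1 + 0 * real (2 * n) + 0 * (real (2 * n) * (real (2 * n) - 1)))
      + (- 1 + 4 * real (2 * n) + (- 8) * (real (2 * n) * (real (2 * n) - 1)))" for n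
  proof -
    consider "n = 0" | "n = 1" | "n = 2" | "n = 3" | "n = 4" | "5 \<le> n" by linarith
    then show ?thesis
    proof cases
      case 6
      then have "5 * 5 \<le> real n * real n" by (intro mult_mono) auto
      with power2_le_nine_power[OF 6] show ?thesis
        by (simp add: power2_eq_square algebra_simps)
    qed simp_all
  qed
  \<comment> \<open>The coefficients for \<open>n < 3\<close> vanish and \<open>d 3 = 512\<close>,
    so \<open>numer_C x\<close> starts with \<open>8/45 * x^6\<close>.\<close>
  have "0 < 1 * cosh (3 * x) + 0 * (3 * x * sinh (3 * x)) + 0 * ((3 * x)\<^sup>2 * cosh (3 * x))
      + ((- 1) * cosh x + 4 * (x * sinh x) + (- 8) * (x\<^sup>2 * cosh x))"
    by (rule hyperbolic_combination_pos[where k = 3, OF x d]) simp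
  also have "\<dots> = 4 * numer_C x"
    unfolding cosh_triple numer_C_def using sinh_square_eq[of x] by algebra
  finally show ?thesis by simp
qed

text \<open>In the notation of the overview this is \<open>2 * (23 a' - 17 b')\<close>. The constant
  23/17 is the limit of \<open>b' / a'\<close> at 0, so the \<open>x^8\<close> terms cancel as
  well.\<close>

lemma numer_A_B_C_upper: "0 < 46 * numer_A x - 34 * numer_B x + 35 * numer_C x"
proof -
  have d: "0 \<le> 9 ^ n * (81 + (- 58 / 3) * real (2 * n)
        + 4 / 3 * (real (2 * n) * (real (2 * n) - 1)))
      + (- 81 + (- 54) * real (2 * n) + (- 108) * (real (2 * n) * (real (2 * n) - 1)))" for n
  proof -
    consider "n = 0" | "n = 1" | "n = 2" | "n = 3" | "n = 4" | "5 \<le> n" by linarith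
    then show ?thesis
    proof cases
      case 6
      \<comment> \<open>Completing the square: four times the quadratic factor of
        \<open>9 ^ n\<close> is this square term plus 11/3.\<close>
      have "0 \<le> (16 * real n - 62)\<^sup>2 / 12" by simp
      then have "11 / 12 \<le> 81 + (- 58 / 3) * real (2 * n)
          + 4 / 3 * (real (2 * n) * (real (2 * n) - 1))"
        by (simp add: power2_eq_square algebra_simps)
      then have "9 ^ n * (11 / 12) \<le> 9 ^ n * (81 + (- 58 / 3) * real (2 * n)
          + 4 / 3 * (real (2 * n) * (real (2 * n) - 1)))"
        by (intro mult_left_mono) auto
      moreover have "81 + 54 * real (2 * n) + 108 * (real (2 * n) * (real (2 * n) - 1))
          \<le> 9 ^ n * (11 / 12)"
      proof -
        have "5 * 5 \<le> real n * real n" using 6 by (intro mult_mono) auto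
        with power2_le_nine_power[OF 6] show ?thesis
          by (simp add: power2_eq_square algebra_simps)
      qed
      ultimately show ?thesis by linarith
    qed simp_all
  qed
  \<comment> \<open>All coefficients for \<open>n < 5\<close> vanish, hence \<open>k = 5\<close>.
    The fractions compensate the factors \<open>3 * x\<close> and \<open>(3 * x)^2\<close>.\<close>
  have "0 < 81 * cosh (3 * x) + (- 58 / 3) * (3 * x * sinh (3 * x))
      + 4 / 3 * ((3 * x)\<^sup>2 * cosh (3 * x))
      + (- 81 * cosh x + (- 54) * (x * sinh x) + (- 108) * (x\<^sup>2 * cosh x))"
    by (rule hyperbolic_combination_pos[where k = 5, OF x d]) simp
  also have "\<dots> = 81 * cosh (3 * x) - 58 * (x * sinh (3 * x)) + 12 * (x\<^sup>2 * cosh (3 * x))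
      - 81 * cosh x - 54 * (x * sinh x) - 108 * (x\<^sup>2 * cosh x)"
    by (simp add: power2_eq_square)
  also have "\<dots> = 4 * (46 * numer_A x - 34 * numer_B x + 35 * numer_C x)"
  proof -
    \<comment> \<open>The two sides agree modulo \<open>cosh^2 - sinh^2 = 1\<close>; with the
      cofactor written out, the claim is a pure polynomial identity.\<close>
    have "(81 * cosh (3 * x) - 58 * (x * sinh (3 * x)) + 12 * (x\<^sup>2 * cosh (3 * x))
      - 81 * cosh x - 54 * (x * sinh x) - 108 * (x\<^sup>2 * cosh x))
      - 4 * (46 * numer_A x - 34 * numer_B x + 35 * numer_C x)
        = ((sinh x)\<^sup>2 - (cosh x)\<^sup>2 + 1) * (136 * x\<^sup>2 * cosh x - 368 * x * sinh x - 324 * cosh x)"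
      unfolding cosh_triple sinh_triple numer_A_def numer_B_def numer_C_def
      by (simp add: algebra_simps power2_eq_square power3_eq_cube)
    then show ?thesis by (simp add: sinh_square_eq)
  qed
  finally show ?thesis by simp
qed

text \<open>This is \<open>4 * (b' - a')\<close>; its series starts at \<open>x^8\<close>. From
  \<open>n = 4\<close> on, the factor of \<open>9 ^ n\<close> is itself positive.\<close>

lemma numer_A_B_C_lower: "0 < 4 * numer_B x - 4 * numer_A x - 5 * numer_C x"
proof -
  have d: "0 \<le> 9 ^ n * (- 9 + 4 / 3 * real (2 * n) + 0 * (real (2 * n) * (real (2 * n) - 1)))
      + (9 + 0 * real (2 * n) + 24 * (real (2 * n) * (real (2 * n) - 1)))" for n
  proof -
    consider "n = 0" | "n = 1" | "n = 2" | "n = 3" | "4 \<le> n" by linarith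
    then show ?thesis
    proof cases
      case 5
      then have "0 \<le> - 9 + 4 / 3 * real (2 * n)" "0 \<le> real (2 * n) - 1" by simp_all
      then have "0 \<le> 9 ^ n * (- 9 + 4 / 3 * real (2 * n))"
          "0 \<le> real (2 * n) * (real (2 * n) - 1)"
        by (intro mult_nonneg_nonneg; simp)+
      then show ?thesis by simp
    qed simp_all
  qed
  have "0 < (- 9) * cosh (3 * x) + 4 / 3 * (3 * x * sinh (3 * x))
      + 0 * ((3 * x)\<^sup>2 * cosh (3 * x))
      + (9 * cosh x + 0 * (x * sinh x) + 24 * (x\<^sup>2 * cosh x))"
    by (rule hyperbolic_combination_pos[where k = 4, OF x d]) simp
  also have "\<dots> = 4 * (x * sinh (3 * x)) - 9 * cosh (3 * x) + 9 * cosh x + 24 * (x\<^sup>2 * cosh x)"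
    by simp
  also have "\<dots> = 4 * (4 * numer_B x - 4 * numer_A x - 5 * numer_C x)"
  proof -
    have "(4 * (x * sinh (3 * x)) - 9 * cosh (3 * x) + 9 * cosh x + 24 * (x\<^sup>2 * cosh x))
      - 4 * (4 * numer_B x - 4 * numer_A x - 5 * numer_C x)
        = ((sinh x)\<^sup>2 - (cosh x)\<^sup>2 + 1) * (32 * x * sinh x + 36 * cosh x - 16 * x\<^sup>2 * cosh x)"
      unfolding cosh_triple sinh_triple numer_A_def numer_B_def numer_C_def
      by (simp add: algebra_simps power2_eq_square power3_eq_cube)
    then show ?thesis by (simp add: sinh_square_eq)
  qed
  finally show ?thesis by simp
qed

lemma numer_pos_if_I1:
  assumes "(p, q) \<in> I1 \<union> {(0, 0)}" "5 / 8 * p - 15 / 8 * q + 1 \<ge> 0"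
  shows "0 < p * numer_A x - q * numer_B x + numer_C x"
proof -
  \<comment> \<open>Near 0 the three functions start with \<open>1/9 * x^6\<close>,
    \<open>1/3 * x^6\<close> and \<open>8/45 * x^6\<close>. Thus 5/8 and 15/8 are the limits of
    \<open>numer_A / numer_C\<close> and \<open>numer_B / numer_C\<close>, and the subtraction
    cancels the leading terms.\<close>
  define a where "a = numer_A x - 5 / 8 * numer_C x"
  define b where "b = numer_B x - 15 / 8 * numer_C x"
  have ab: "a < b" "17 * b < 23 * a"
    using numer_A_B_C_lower numer_A_B_C_upper by (simp_all add: a_def b_def)
  \<comment> \<open>Together the bounds give \<open>17 * a < 23 * a\<close>.\<close>
  then have "0 < a" "0 < b" by linarith+
  have eq: "p * numer_A x - q * numer_B x + numer_C x
      = p * a - q * b + (5 / 8 * p - 15 / 8 * q + 1) * numer_C x"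
    by (simp add: a_def b_def algebra_simps)
  have nonneg: "0 \<le> (5 / 8 * p - 15 / 8 * q + 1) * numer_C x"
    using assms(2) numer_C_pos by simp
  \<comment> \<open>At the origin strictness comes from \<open>numer_C\<close>; in the other cases
    it comes from \<open>p * a - q * b\<close>, so equality in the linear condition is
    harmless.\<close>
  consider "p = 0" "q = 0" | "q = 0" "0 < p" | "0 < q" "23 / 17 * q \<le> p" | "q < 0" "q \<le> p"
    using assms(1) by (auto simp: I1_def field_simps)
  then show ?thesis
  proof cases
    case 1
    then show ?thesis using numer_C_pos by simp
  next
    case 2
    with \<open>0 < a\<close> nonneg show ?thesis unfolding eq by (auto intro!: add_pos_nonneg)
  next
    case 3
    have "q * b < q * (23 / 17 * a)" using 3 ab by (intro mult_strict_left_mono) auto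
    also have "\<dots> \<le> p * a" using 3 \<open>0 < a\<close> by (simp add: mult_right_mono)
    finally show ?thesis unfolding eq using nonneg by simp
  next
    case 4
    have "q * b < q * a" using 4 ab by simp
    also have "\<dots> \<le> p * a" using 4 \<open>0 < a\<close> by (simp add: mult_right_mono)
    finally show ?thesis unfolding eq using nonneg by simp
  qed
qed

text \<open>Mirror image of the positive case: the bounds \<open>a < b\<close> and
  \<open>17 * b < 23 * a\<close> exchange their roles for the two signs of \<open>q\<close>.\<close>

lemma numer_neg_if_I2:
  assumes "(p, q) \<in> I2" "5 / 8 * p - 15 / 8 * q + 1 \<le> 0"
  shows "p * numer_A x - q * numer_B x + numer_C x < 0"
proof -
  define a where "a = numer_A x - 5 / 8 * numer_C x"
  define b where "b = numer_B x - 15 / 8 * numer_C x"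
  have ab: "a < b" "17 * b < 23 * a"
    using numer_A_B_C_lower numer_A_B_C_upper by (simp_all add: a_def b_def)
  then have "0 < a" "0 < b" by linarith+
  have eq: "p * numer_A x - q * numer_B x + numer_C x
      = p * a - q * b + (5 / 8 * p - 15 / 8 * q + 1) * numer_C x"
    by (simp add: a_def b_def algebra_simps)
  have nonpos: "(5 / 8 * p - 15 / 8 * q + 1) * numer_C x \<le> 0"
    using assms(2) numer_C_pos by (simp add: mult_nonpos_nonneg)
  consider "q = 0" "p < 0" | "0 < q" "p \<le> q" | "q < 0" "p \<le> 23 / 17 * q"
    using assms(1) by (auto simp: I2_def field_simps)
  then have "p * a < q * b"
  proof cases
    case 1
    with \<open>0 < a\<close> show ?thesis by (simp add: mult_neg_pos)
  next
    case 2
    have "p * a \<le> q * a" using 2 \<open>0 < a\<close> by (simp add: mult_right_mono)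
    also have "\<dots> < q * b" using 2 ab by simp
    finally show ?thesis .
  next
    case 3
    have "p * a \<le> q * (23 / 17 * a)" using 3 \<open>0 < a\<close> by (simp add: mult_right_mono)
    also have "\<dots> < q * b" using 3 ab by (intro mult_strict_left_mono_neg) auto
    finally show ?thesis .
  qed
  with nonpos show ?thesis unfolding eq by simp
qed

end

section \<open>The quotient of derivatives\<close>

text \<open>One formula covers the power and the logarithm, so nothing later splits on
  \<open>p = 0\<close> or \<open>q = 0\<close>.\<close>

lemma U_has_real_derivative:
  assumes "0 < t"
  shows "(U r has_real_derivative t powr (r - 1)) (at t)"
proof (cases "r = 0")
  case True
  have "U r = ln" by (simp add: fun_eq_iff U_def True)
  then show ?thesis
    using DERIV_ln[OF assms] assms by (simp add: True powr_minus)
next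
  case False
  have "U r = (\<lambda>t. (t powr r - 1) / r)" by (simp add: fun_eq_iff U_def False)
  then show ?thesis
    using False assms by (auto intro!: derivative_eq_intros)
qed

lemma tendsto_U_1:
  assumes "(f \<longlongrightarrow> 1) F"
  shows "((\<lambda>x. U r (f x)) \<longlongrightarrow> 0) F"
proof -
  have "isCont (U r) 1"
    using U_has_real_derivative[of 1 r] by (auto intro: DERIV_isCont)
  then have "((\<lambda>x. U r (f x)) \<longlongrightarrow> U r 1) F"
    using assms by (rule isCont_tendsto_compose)
  moreover have "U r 1 = 0" by (simp add: U_def)
  ultimately show ?thesis by simp
qed

lemma sinh_over_tendsto_1: "((\<lambda>x :: real. sinh x / x) \<longlongrightarrow> 1) (at_right 0)"
proof -
  have "(sinh has_real_derivative 1) (at (0 :: real))"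
    by (auto intro!: derivative_eq_intros)
  then have "((\<lambda>x :: real. sinh x / x) \<longlongrightarrow> 1) (at 0)"
    by (simp add: has_field_derivative_iff)
  then show ?thesis by (rule tendsto_within_subset) auto
qed

text \<open>The difference tends to 0 at 0 and has derivative \<open>t * sinh t\<close>. It is a
  factor of the derivative of \<open>sinh x / x\<close> and an argument of \<open>ln\<close>
  below.\<close>

lemma sinh_less_mult_cosh:
  assumes "0 < (x :: real)"
  shows "sinh x < x * cosh x"
proof -
  have "0 < x * cosh x - sinh x"
  proof (rule pos_if_deriv_pos_tendsto_0[OF assms,
        where f = "\<lambda>x. x * cosh x - sinh x" and f' = "\<lambda>t. t * sinh t"])
    have "isCont (\<lambda>x :: real. x * cosh x - sinh x) 0"
      by (intro continuous_intros)
    then show "((\<lambda>x :: real. x * cosh x - sinh x) \<longlongrightarrow> 0) (at_right 0)"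
      by (auto simp: isCont_def intro: tendsto_within_subset)
  qed (auto intro!: derivative_eq_intros)
  then show ?thesis by simp
qed

text \<open>For \<open>x > 0\<close> this is the logarithm of the quotient of the derivatives of
  \<open>U p (sinh x / x)\<close> and \<open>U q (cosh x)\<close>, expanded so that it is affine in
  \<open>p\<close> and \<open>q\<close>.\<close>

definition log_ratio :: "real \<Rightarrow> real \<Rightarrow> real \<Rightarrow> real" where
  "log_ratio p q x = (p - 1) * (ln (sinh x) - ln x) + (1 - q) * ln (cosh x)
     + ln (x * cosh x - sinh x) - 2 * ln x - ln (sinh x)"

lemma log_ratio_has_real_derivative:
  assumes "0 < x"
  shows "(log_ratio p q has_real_derivative
    (p * numer_A x - q * numer_B x + numer_C x)
      / (x * sinh x * cosh x * (x * cosh x - sinh x))) (at x)"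
proof -
  define s c e where "s = sinh x" and "c = cosh x" and "e = x * cosh x - sinh x"
  have pos: "0 < s" "0 < c" "0 < e"
    using assms sinh_less_mult_cosh[OF assms] by (simp_all add: s_def c_def e_def)
  have "(log_ratio p q has_real_derivative
      (p - 1) * (c / s - 1 / x) + (1 - q) * (s / c) + x * s / e - 2 / x - c / s) (at x)"
    unfolding log_ratio_def [abs_def] s_def c_def e_def
    using assms sinh_less_mult_cosh[OF assms]
    by (auto intro!: derivative_eq_intros simp: divide_inverse)
  also have "(p - 1) * (c / s - 1 / x) + (1 - q) * (s / c) + x * s / e - 2 / x - c / s
    = ((p - 1) * (x * c - s) * c * e + (1 - q) * s * s * x * e + x * s * x * s * c
      - 2 * s * c * e - c * c * x * e) / (x * s * c * e)"
    using pos assms by (simp add: divide_simps) (simp add: algebra_simps)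
  also have "(p - 1) * (x * c - s) * c * e + (1 - q) * s * s * x * e + x * s * x * s * c
      - 2 * s * c * e - c * c * x * e = p * numer_A x - q * numer_B x + numer_C x"
  proof -
    \<comment> \<open>Again equality modulo \<open>cosh^2 - sinh^2 = 1\<close>, with explicit
      cofactor.\<close>
    have "((p - 1) * (x * c - s) * c * e + (1 - q) * s * s * x * e + x * s * x * s * c
      - 2 * s * c * e - c * c * x * e) - (p * numer_A x - q * numer_B x + numer_C x)
        = ((sinh x)\<^sup>2 - (cosh x)\<^sup>2 + 1) * (2 * x\<^sup>2 * cosh x - x * sinh x)"
      unfolding numer_A_def numer_B_def numer_C_def s_def c_def e_def
      by (simp add: algebra_simps power2_eq_square power3_eq_cube)
    then show ?thesis by (simp add: sinh_square_eq)
  qed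
  finally show ?thesis unfolding s_def c_def e_def .
qed

lemma cosh_U_has_real_derivative:
  "0 < x \<Longrightarrow> ((\<lambda>x. U q (cosh x)) has_real_derivative cosh x powr (q - 1) * sinh x) (at x)"
  by (rule DERIV_chain2[OF U_has_real_derivative]) (auto intro!: derivative_eq_intros)

text \<open>The derivative is stated as a multiple of that of \<open>U q (cosh x)\<close>, the shape
  \<open>k x * g' x\<close> required by \<open>strict_mono_on_quotient\<close>.\<close>

lemma sinh_U_has_real_derivative:
  assumes "0 < x"
  shows "((\<lambda>x. U p (sinh x / x)) has_real_derivative
    exp (log_ratio p q x) * (cosh x powr (q - 1) * sinh x)) (at x)"
proof -
  have pos: "0 < sinh x" "0 < x * cosh x - sinh x"
    using assms sinh_less_mult_cosh[OF assms] by simp_all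
  have "((\<lambda>x. sinh x / x) has_real_derivative (x * cosh x - sinh x) / x\<^sup>2) (at x)"
    using assms by (auto intro!: derivative_eq_intros simp: power2_eq_square)
  from DERIV_chain2[OF U_has_real_derivative this, of p]
  have "((\<lambda>x. U p (sinh x / x)) has_real_derivative
      (sinh x / x) powr (p - 1) * ((x * cosh x - sinh x) / x\<^sup>2)) (at x)"
    using assms by simp
  also have "(sinh x / x) powr (p - 1) * ((x * cosh x - sinh x) / x\<^sup>2)
      = exp (log_ratio p q x) * (cosh x powr (q - 1) * sinh x)"
  proof -
    have "exp (log_ratio p q x) = exp ((p - 1) * (ln (sinh x) - ln x)) * exp ((1 - q) * ln (cosh x))
        * (x * cosh x - sinh x) / (x\<^sup>2 * sinh x)"
      using pos assms
      by (simp add: log_ratio_def exp_add exp_diff exp_double)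
    moreover have "exp ((1 - q) * ln (cosh x)) * exp ((q - 1) * ln (cosh x)) = 1"
      unfolding exp_add[symmetric] by (simp add: algebra_simps)
    moreover have "(sinh x / x) powr (p - 1) = exp ((p - 1) * (ln (sinh x) - ln x))"
      using pos assms by (simp add: powr_def ln_div)
    moreover have "cosh x powr (q - 1) = exp ((q - 1) * ln (cosh x))"
      by (simp add: powr_def)
    ultimately show ?thesis
      using pos assms by (simp add: divide_simps) algebra
  qed
  finally show ?thesis .
qed

theorem proposition1:
  fixes p q :: real
  shows "((p, q) \<in> I1 \<union> {(0, 0)} \<and> 5 / 8 * p - 15 / 8 * q + 1 \<ge> 0 \<longrightarrow>
            strict_mono_on {0<..} (H p q)) \<and>
         ((p, q) \<in> I2 \<and> 5 / 8 * p - 15 / 8 * q + 1 \<le> 0 \<longrightarrow>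
            strict_antimono_on {0<..} (H p q))"
proof (intro conjI impI; elim conjE)
  have f: "((\<lambda>x. U p (sinh x / x)) \<longlongrightarrow> 0) (at_right 0)"
    by (intro tendsto_U_1 sinh_over_tendsto_1)
  have "isCont cosh (0 :: real)" by (intro continuous_intros)
  then have g: "((\<lambda>x :: real. U q (cosh x)) \<longlongrightarrow> 0) (at_right 0)"
    by (intro tendsto_U_1) (auto simp: isCont_def intro: tendsto_within_subset)
  have g': "0 < cosh x powr (q - 1) * sinh x" if "0 < x" for x :: real
    using that by simp
  have denom: "0 < x * sinh x * cosh x * (x * cosh x - sinh x)" if "0 < x" for x :: real
    using that sinh_less_mult_cosh[OF that] by simp
  {
    assume *: "(p, q) \<in> I1 \<union> {(0, 0)}" "5 / 8 * p - 15 / 8 * q + 1 \<ge> 0"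
    have "strict_mono_on {0<..} (\<lambda>x. exp (log_ratio p q x))"
    proof (rule strict_mono_onI)
      fix u v :: real assume uv: "u \<in> {0<..}" "v \<in> {0<..}" "u < v"
      have "log_ratio p q u < log_ratio p q v"
      proof (rule DERIV_pos_imp_increasing[OF \<open>u < v\<close>])
        fix x assume "u \<le> x" "x \<le> v"
        then have "0 < x" using uv by auto
        show "\<exists>y. (log_ratio p q has_real_derivative y) (at x) \<and> 0 < y"
          using log_ratio_has_real_derivative[OF \<open>0 < x\<close>]
            divide_pos_pos[OF numer_pos_if_I1[OF \<open>0 < x\<close> *] denom[OF \<open>0 < x\<close>]] by blast
      qed
      then show "exp (log_ratio p q u) < exp (log_ratio p q v)" by simp
    qed
    from strict_mono_on_quotient[OF f g sinh_U_has_real_derivative cosh_U_has_real_derivative g' this]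
    show "strict_mono_on {0<..} (H p q)" by (simp add: H_def [abs_def])
  }
  {
    assume *: "(p, q) \<in> I2" "5 / 8 * p - 15 / 8 * q + 1 \<le> 0"
    \<comment> \<open>The l'Hospital rule is stated for increasing quotients, so the numerator is
      negated, and \<open>k\<close> with it.\<close>
    have k: "strict_mono_on {0<..} (\<lambda>x. - exp (log_ratio p q x))"
    proof (rule strict_mono_onI)
      fix u v :: real assume uv: "u \<in> {0<..}" "v \<in> {0<..}" "u < v"
      have "log_ratio p q v < log_ratio p q u"
      proof (rule DERIV_neg_imp_decreasing[OF \<open>u < v\<close>])
        fix x assume "u \<le> x" "x \<le> v"
        then have "0 < x" using uv by auto
        show "\<exists>y. (log_ratio p q has_real_derivative y) (at x) \<and> y < 0"
          using log_ratio_has_real_derivative[OF \<open>0 < x\<close>]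
            divide_neg_pos[OF numer_neg_if_I2[OF \<open>0 < x\<close> *] denom[OF \<open>0 < x\<close>]] by blast
      qed
      then show "- exp (log_ratio p q u) < - exp (log_ratio p q v)" by simp
    qed
    have "strict_mono_on {0<..} (\<lambda>x. - U p (sinh x / x) / U q (cosh x))"
    proof (rule strict_mono_on_quotient[OF _ g _ cosh_U_has_real_derivative g' k])
      show "((\<lambda>x. - U p (sinh x / x)) \<longlongrightarrow> 0) (at_right 0)"
        using tendsto_minus[OF f] by simp
      show "((\<lambda>x. - U p (sinh x / x)) has_real_derivative
          - exp (log_ratio p q x) * (cosh x powr (q - 1) * sinh x)) (at x)" if "0 < x" for x
        using DERIV_minus[OF sinh_U_has_real_derivative[OF that]] by simp
    qed
    then show "strict_antimono_on {0<..} (H p q)"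
      by (simp add: H_def [abs_def] monotone_on_def)
  }
qed

end
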